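(* Let $\lambda$ be a partition and let $\sigma\in\mathfrak{S}_{\ell(\lambda)}$. The map $$\Psi_\sigma:\coprod_{\alpha\,:\,\widetilde{\alpha}=\lambda}\mathrm{PCT}^{\sigma}(\alpha)\longrightarrow \mathrm{RT}(\lambda)$$ is a bijection, and its inverse is the map $\overline{\phi}_{\sigma}$.
   Context: A composition $\alpha=(\alpha_1,\dots,\alpha_k)$ of $n$ is a finite sequence of positive integers with sum $|\alpha|=n$; its length is $\ell(\alpha)=k$. Its composition diagram is the left-justified array of cells whose $i$-th row from the top has $\alpha_i$ cells; cell $(i,j)$ is in row $i$, column $j$. A partition is a composition with weakly decreasing parts; $\widetilde{\alpha}$ denotes the partition obtained by sorting the parts of $\alpha$ in weakly decreasing order. For a word $w=w_1\cdots w_m$ of positive integers, its standardization $\mathrm{stan}(w)$ is the unique $\pi\in\mathfrak{S}_m$ with $\pi(i)>\pi(j)$ iff $w_i>w_j$ for all $i<j$. A reverse tableau of shape $\lambda$ is a filling of the Young diagram of $\lambda$ (English notation) with positive integers whose rows weakly decrease from left to right and whose columns strictly decrease from top to bottom. $\mathrm{RT}(\lambda)$ is the set of reverse tableaux of shape $\lambda$ with all entries at most $|\lambda|$. For a composition $\alpha$ and $\sigma\in\mathfrak{S}_{\ell(\alpha)}$, a permuted composition tableau (PCT) of shape $\alpha$ and type $\sigma$ is a filling of the composition diagram of $\alpha$ with positive integers such that: (1) the entries of the first column are distinct and the standardization of the word obtained by reading the first column top to bottom is $\sigma$; (2) entries weakly decrease along each row from left to right; (3) (triple condition) whenever $i<r$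 and the cells $(i,j)$, $(i,j+1)$, $(r,j+1)$ all lie in the diagram, with entries $a,b,c$ respectively, $a\ge c$ implies $b>c$. $\mathrm{PCT}^\sigma(\alpha)$ is the set of PCTs of shape $\alpha$ and type $\sigma$ with all entries at most $|\alpha|$. The map $\Psi_\sigma$: given $\tau\in\mathrm{PCT}^\sigma(\alpha)$ with $\widetilde\alpha=\lambda$, for each column index $i$ take the entries of column $i$ of $\tau$ in decreasing order and write them in column $i$ of the Young diagram of $\lambda$ from top to bottom. The map $\overline{\phi}_\sigma$: given $T\in\mathrm{RT}(\lambda)$, build a filling $\tau$ by (1) writing the entries of the first column of $T$ in the first column of rows $1,2,\dots,\ell(\lambda)$ so that the standardization of the first column read top to bottom is $\sigma$; (2) taking the entries of column $2$ of $T$ in decreasing order and placing each one in the next empty cell of the row with the smallest index such that the cell immediately to its left is filled and the row entries weakly decrease from left to right (i.e. the entry immediately to its left is at least the entry being placed); (3) repeating step (2) with the entries of column $k$ of $T$ for $k=3,\dots,\lambda_1$.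
   Formalization: The triple condition is imposed also when cell (i,j+1) is absent: if i<r, cells (i,j), (r,j+1) lie in the diagram and a≥c, then (i,j+1) must lie in the diagram and b>c. Read literally, the claim fails for λ=(2,1), σ=21: 2 1 / 1 and 2 / 1 1 have the same image. *)

theory Defs
  imports Main "HOL-Library.FuncSet" "HOL-Library.Multiset" "HOL-Combinatorics.Permutations"
begin

text \<open>Cells, rows, columns and positions in words are numbered from 1; the entry of a list
  \<open>w\<close> at position \<open>i\<close> is \<open>w ! (i - 1)\<close>.\<close>

definition is_composition :: "nat list \<Rightarrow> bool" where
  "is_composition \<alpha> \<longleftrightarrow> (\<forall>a\<in>set \<alpha>. 0 < a)"

definition is_partition :: "nat list \<Rightarrow> bool" where
  "is_partition \<alpha> \<longleftrightarrow> is_composition \<alpha> \<and> sorted_wrt (\<ge>) \<alpha>"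

definition dsort :: "nat list \<Rightarrow> nat list" where
  "dsort xs = rev (sort xs)"

definition diagram :: "nat list \<Rightarrow> (nat \<times> nat) set" where
  "diagram \<alpha> = {(i, j). 1 \<le> i \<and> i \<le> length \<alpha> \<and> 1 \<le> j \<and> j \<le> \<alpha> ! (i - 1)}"

text \<open>A filling is a function on all of \<open>nat \<times> nat\<close>; the value 0 marks a cell without an entry.\<close>

type_synonym filling = "nat \<times> nat \<Rightarrow> nat"

definition is_filling :: "nat list \<Rightarrow> filling \<Rightarrow> bool" where
  "is_filling \<alpha> \<tau> \<longleftrightarrow> (\<forall>c. 0 < \<tau> c \<longleftrightarrow> c \<in> diagram \<alpha>)"

definition column :: "nat list \<Rightarrow> filling \<Rightarrow> nat \<Rightarrow> nat list" where
  "column \<alpha> \<tau> j = [\<tau> (i, j). i \<leftarrow> [1..<Suc (length \<alpha>)], (i, j) \<in> diagram \<alpha>]"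

definition rows_weakly_decrease :: "nat list \<Rightarrow> filling \<Rightarrow> bool" where
  "rows_weakly_decrease \<alpha> \<tau> \<longleftrightarrow>
     (\<forall>i j k. (i, j) \<in> diagram \<alpha> \<and> (i, k) \<in> diagram \<alpha> \<and> j < k \<longrightarrow> \<tau> (i, k) \<le> \<tau> (i, j))"

definition columns_strictly_decrease :: "nat list \<Rightarrow> filling \<Rightarrow> bool" where
  "columns_strictly_decrease \<alpha> \<tau> \<longleftrightarrow>
     (\<forall>i r j. (i, j) \<in> diagram \<alpha> \<and> (r, j) \<in> diagram \<alpha> \<and> i < r \<longrightarrow> \<tau> (r, j) < \<tau> (i, j))"

definition is_reverse_tableau :: "nat list \<Rightarrow> filling \<Rightarrow> bool" where
  "is_reverse_tableau lam T \<longleftrightarrow>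
     is_filling lam T \<and> rows_weakly_decrease lam T \<and> columns_strictly_decrease lam T"

definition RT :: "nat list \<Rightarrow> filling set" where
  "RT lam = {T. is_reverse_tableau lam T \<and> (\<forall>c\<in>diagram lam. T c \<le> sum_list lam)}"

definition stan :: "nat list \<Rightarrow> nat \<Rightarrow> nat" where
  "stan w = (THE \<pi>. \<pi> permutes {1..length w} \<and>
     (\<forall>i j. 1 \<le> i \<and> i < j \<and> j \<le> length w \<longrightarrow> (\<pi> i > \<pi> j \<longleftrightarrow> w ! (i - 1) > w ! (j - 1))))"

text \<open>In the triple condition (entries \<open>a\<close>, \<open>b\<close>, \<open>c\<close> in cells \<open>(i, j)\<close>, \<open>(i, j + 1)\<close>,
  \<open>(r, j + 1)\<close>) the conclusion \<open>b > c\<close> includes the existence of the cell \<open>(i, j + 1)\<close>,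
  that is, a missing \<open>b\<close> counts as 0. This is the usual convention for composition tableaux, and
  it is essential: if the condition were imposed only when all three cells are present, then the
  fillings with rows \<open>2 1 / 1\<close> and \<open>2 / 1 1\<close> would both be tableaux of type 21, and sorting
  their columns gives the same reverse tableau.\<close>

definition triple_condition :: "nat list \<Rightarrow> filling \<Rightarrow> bool" where
  "triple_condition \<alpha> \<tau> \<longleftrightarrow>
     (\<forall>i r j. i < r \<and> (i, j) \<in> diagram \<alpha> \<and> (r, j + 1) \<in> diagram \<alpha> \<and> \<tau> (i, j) \<ge> \<tau> (r, j + 1)
        \<longrightarrow> (i, j + 1) \<in> diagram \<alpha> \<and> \<tau> (i, j + 1) > \<tau> (r, j + 1))"

definition is_PCT :: "(nat \<Rightarrow> nat) \<Rightarrow> nat list \<Rightarrow> filling \<Rightarrow> bool" where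
  "is_PCT \<sigma> \<alpha> \<tau> \<longleftrightarrow>
     is_filling \<alpha> \<tau> \<and>
     distinct (column \<alpha> \<tau> 1) \<and> stan (column \<alpha> \<tau> 1) = \<sigma> \<and>
     rows_weakly_decrease \<alpha> \<tau> \<and>
     triple_condition \<alpha> \<tau>"

definition PCT :: "(nat \<Rightarrow> nat) \<Rightarrow> nat list \<Rightarrow> filling set" where
  "PCT \<sigma> \<alpha> = {\<tau>. is_PCT \<sigma> \<alpha> \<tau> \<and> (\<forall>c\<in>diagram \<alpha>. \<tau> c \<le> sum_list \<alpha>)}"

definition PCT_coproduct :: "(nat \<Rightarrow> nat) \<Rightarrow> nat list \<Rightarrow> (nat list \<times> filling) set" where
  "PCT_coproduct \<sigma> lam = (SIGMA \<alpha>:{\<alpha>. is_composition \<alpha> \<and> dsort \<alpha> = lam}. PCT \<sigma> \<alpha>)"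

text \<open>The map \<open>\<Psi>\<^sub>\<sigma>\<close> depends on \<open>\<sigma>\<close> only through its domain.\<close>

definition Psi :: "nat list \<times> filling \<Rightarrow> filling" where
  "Psi = (\<lambda>(\<alpha>, \<tau>) (i, j).
     if (i, j) \<in> diagram (dsort \<alpha>) then dsort (column \<alpha> \<tau> j) ! (i - 1) else 0)"

definition first_column_word :: "(nat \<Rightarrow> nat) \<Rightarrow> nat list \<Rightarrow> filling \<Rightarrow> nat list" where
  "first_column_word \<sigma> lam T = (THE w. mset w = mset (column lam T 1) \<and> stan w = \<sigma>)"

definition initial_filling :: "(nat \<Rightarrow> nat) \<Rightarrow> nat list \<Rightarrow> filling \<Rightarrow> filling" where
  "initial_filling \<sigma> lam T = (\<lambda>(i, j).
     if 1 \<le> i \<and> i \<le> length lam \<and> j = 1 then first_column_word \<sigma> lam T ! (i - 1) else 0)"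

text \<open>Entries of column \<open>k\<close> of the reverse tableau go to column \<open>k\<close> of the filling under
  construction: the cell that receives \<open>x\<close> is an empty cell of column \<open>k\<close> whose left
  neighbour is filled.\<close>

definition place :: "nat \<Rightarrow> nat \<Rightarrow> filling \<Rightarrow> filling" where
  "place k x \<tau> =
     \<tau>((LEAST r. \<tau> (r, k) = 0 \<and> \<tau> (r, k - 1) \<noteq> 0 \<and> \<tau> (r, k - 1) \<ge> x, k) := x)"

definition phi_filling :: "(nat \<Rightarrow> nat) \<Rightarrow> nat list \<Rightarrow> filling \<Rightarrow> filling" where
  "phi_filling \<sigma> lam T =
     fold (\<lambda>k. fold (place k) (dsort (column lam T k)))
       [2..<Suc (case lam of [] \<Rightarrow> 0 | l # _ \<Rightarrow> l)] (initial_filling \<sigma> lam T)"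

definition row_lengths :: "nat \<Rightarrow> filling \<Rightarrow> nat list" where
  "row_lengths m \<tau> = map (\<lambda>i. card {j. \<tau> (i, j) \<noteq> 0}) [1..<Suc m]"

definition phi_bar :: "(nat \<Rightarrow> nat) \<Rightarrow> nat list \<Rightarrow> filling \<Rightarrow> nat list \<times> filling" where
  "phi_bar \<sigma> lam T = (row_lengths (length lam) (phi_filling \<sigma> lam T), phi_filling \<sigma> lam T)"

end

theory Submission imports Defs begin

text \<open>A permuted composition tableau is determined by its type and the sets of entries of its
  columns. The first column is determined by its set and \<open>\<sigma>\<close>. When the entries of column
  \<open>k + 1\<close> are inserted in decreasing order, the triple condition says that every row above that
  of \<open>x\<close> whose entry in column \<open>k\<close> is at least \<open>x\<close> already received an entry larger than
  \<open>x\<close>; so \<open>x\<close> sits exactly where the greedy algorithm puts it, and \<open>phi_bar\<close> is a left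
  inverse of \<open>Psi\<close>. Conversely the greedy choice succeeds as soon as, for every threshold
  \<open>x\<close>, column \<open>k\<close> has at least as many entries \<open>\<ge> x\<close> as column \<open>k + 1\<close>; this counting
  condition holds for reverse tableaux, which gives surjectivity, and it is also what makes the
  rows of \<open>Psi (\<alpha>, \<tau>)\<close> weakly decreasing.\<close>

section \<open>Finite sets listed in decreasing order\<close>

text \<open>Columns of tableaux have distinct entries, so each is handled as a set; this list is the
  order in which \<open>Psi\<close> writes a column and the algorithm inserts it.\<close>

definition desc :: "nat set \<Rightarrow> nat list" where
  "desc A = rev (sorted_list_of_set A)"

lemma sorted_wrt_desc: "sorted_wrt (>) (desc A)"
  unfolding desc_def sorted_wrt_rev
  using strict_sorted_list_of_set[of A] by simp

lemma set_desc [simp]: "finite A \<Longrightarrow> set (desc A) = A"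
  and length_desc [simp]: "length (desc A) = card A"
  and distinct_desc [simp]: "distinct (desc A)"
  by (auto simp: desc_def)

lemma dsort_distinct: "distinct xs \<Longrightarrow> dsort xs = desc (set xs)"
  by (simp add: dsort_def desc_def sorted_list_of_set_sort_remdups distinct_remdups_id)

lemma sorted_wrt_greater_eq_desc:
  assumes "sorted_wrt (>) xs"
  shows "xs = desc (set xs)"
proof -
  have *: "sorted_wrt (<) (rev xs)" using assms by (simp add: sorted_wrt_rev)
  hence "distinct (rev xs)" "sorted (rev xs)" by (auto simp: strict_sorted_iff)
  hence "rev xs = sorted_list_of_set (set (rev xs))"
    by (metis sorted_list_of_set.idem_if_sorted_distinct)
  thus ?thesis unfolding desc_def by (metis rev_rev_ident set_rev)
qed

text \<open>With x the entry of \<open>desc B\<close> at position i (counted from 0), at least i + 1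
  elements of B are at least x, hence also at least i + 1 elements of A. This converts the counting
  condition into row inequalities.\<close>

lemma desc_nth_le:
  assumes fin: "finite A" "finite B"
    and i: "i < card B"
    and le: "\<And>x. x \<in> B \<Longrightarrow> card {b\<in>B. x \<le> b} \<le> card {a\<in>A. x \<le> a}"
  shows "i < card A \<and> desc B ! i \<le> desc A ! i"
proof -
  define x where "x = desc B ! i"
  have "x \<in> B" unfolding x_def using i fin by (metis length_desc nth_mem set_desc)
  have "set (take (Suc i) (desc B)) \<subseteq> {b\<in>B. x \<le> b}"
  proof
    fix b assume "b \<in> set (take (Suc i) (desc B))"
    then obtain m where m: "m < Suc i" "m < card B" "b = desc B ! m"
      by (auto simp: in_set_conv_nth)
    have "b \<in> B" using m fin by (metis length_desc nth_mem set_desc)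
    moreover have "x \<le> b"
      using m i sorted_wrt_nth_less[OF sorted_wrt_desc, of m i B]
      by (cases "m = i") (auto simp: x_def)
    ultimately show "b \<in> {b\<in>B. x \<le> b}" by simp
  qed
  from card_mono[OF _ this] fin i have "Suc i \<le> card {b\<in>B. x \<le> b}"
    by (simp add: distinct_card)
  with le[OF \<open>x \<in> B\<close>] have c: "Suc i \<le> card {a\<in>A. x \<le> a}" by simp
  have "card {a\<in>A. x \<le> a} \<le> card A" by (rule card_mono) (use fin in auto)
  with c have iA: "i < card A" by simp
  have "x \<le> desc A ! i"
  proof (rule ccontr)
    assume less: "\<not> x \<le> desc A ! i"
    \<comment> \<open>If position i of A held less than x, only the i earlier positions could reach
      x, against the i + 1 elements given by \<open>c\<close>.\<close>
    have "{a\<in>A. x \<le> a} \<subseteq> set (take i (desc A))"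
    proof
      fix a assume a: "a \<in> {a\<in>A. x \<le> a}"
      then obtain m where m: "m < card A" "a = desc A ! m"
        using fin by (metis (no_types, lifting) in_set_conv_nth length_desc mem_Collect_eq set_desc)
      have "m < i"
      proof (rule ccontr)
        assume "\<not> m < i"
        hence "desc A ! m \<le> desc A ! i"
          using m sorted_wrt_nth_less[OF sorted_wrt_desc, of i m A]
          by (cases "m = i") auto
        with a m less show False by simp
      qed
      thus "a \<in> set (take i (desc A))" using m iA by (auto simp: in_set_conv_nth)
    qed
    from card_mono[OF _ this] have "card {a\<in>A. x \<le> a} \<le> i"
      using card_length[of "take i (desc A)"] by simp
    with c show False by simp
  qed
  with iA show ?thesis by (simp add: x_def)
qed

section \<open>Fillings and their column sets\<close>

text \<open>No shape is mentioned: nonzero values mark the cells, so a tableau and its image under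
  \<open>Psi\<close>, of different shapes, can be compared column by column.\<close>

definition colset :: "filling \<Rightarrow> nat \<Rightarrow> nat set" where
  "colset \<tau> j = (\<lambda>i. \<tau> (i, j)) ` {i. \<tau> (i, j) \<noteq> 0}"

lemma zero_notin_colset: "0 \<notin> colset \<tau> j"
  by (auto simp: colset_def)

text \<open>Distinct entries allow counting rows instead of entries. Since x is positive, every row
  counted lies in the support, where p is injective.\<close>

lemma card_image_ge:
  fixes p :: "nat \<Rightarrow> nat"
  assumes "inj_on p {i. p i \<noteq> 0}" "0 < x"
  shows "card {a \<in> p ` {i. p i \<noteq> 0}. x \<le> a} = card {i. x \<le> p i}"
proof -
  have "{a \<in> p ` {i. p i \<noteq> 0}. x \<le> a} = p ` {i. x \<le> p i}"
    using assms(2) by auto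
  moreover have "inj_on p {i. x \<le> p i}"
    by (rule inj_on_subset[OF assms(1)]) (use assms(2) in auto)
  ultimately show ?thesis by (simp add: card_image)
qed

lemma down_closed_eq_atLeastAtMost:
  fixes D :: "nat set"
  assumes "finite D" "0 \<notin> D" "\<And>i k. \<lbrakk>i \<in> D; 1 \<le> k; k \<le> i\<rbrakk> \<Longrightarrow> k \<in> D"
  shows "D = {1..card D}"
proof (cases "D = {}")
  case False
  have "D = {1..Max D}"
    using assms Max_in[OF assms(1) False] Max_ge[OF assms(1)]
    by (auto intro: assms(3) simp: Suc_le_eq intro!: gr0I)
  thus ?thesis by (metis card_atLeastAtMost diff_Suc_1 One_nat_def)
qed simp

section \<open>Cells and heights of the columns of a shape\<close>

lemma concat_map_if: "concat (map (\<lambda>i. if P i then [f i] else []) xs) = map f (filter P xs)"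
  by (induction xs) auto

lemma column_eq:
  "column \<alpha> \<tau> j = map (\<lambda>i. \<tau> (i, j)) (filter (\<lambda>i. (i, j) \<in> diagram \<alpha>) [1..<Suc (length \<alpha>)])"
  unfolding column_def by (rule concat_map_if)

lemma fillingD: "is_filling \<alpha> \<tau> \<Longrightarrow> \<tau> c \<noteq> 0 \<longleftrightarrow> c \<in> diagram \<alpha>"
  by (metis bot_nat_0.not_eq_extremum is_filling_def)

lemma diagram_col_set:
  "set (filter (\<lambda>i. (i, j) \<in> diagram \<alpha>) [1..<Suc (length \<alpha>)]) = {i. (i, j) \<in> diagram \<alpha>}"
  by (auto simp: diagram_def)

lemma finite_diagram_col [simp]: "finite {i. (i, j) \<in> diagram \<alpha>}"
  using diagram_col_set[of j \<alpha>] by (metis List.finite_set)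

lemma set_column:
  assumes "is_filling \<alpha> \<tau>"
  shows "set (column \<alpha> \<tau> j) = colset \<tau> j"
  using diagram_col_set[of j \<alpha>] fillingD[OF assms]
  by (simp add: column_eq colset_def del: set_filter set_upt upt_Suc)

lemma distinct_column:
  assumes "is_filling \<alpha> \<tau>"
  shows "distinct (column \<alpha> \<tau> j) \<longleftrightarrow> inj_on (\<lambda>i. \<tau> (i, j)) {i. \<tau> (i, j) \<noteq> 0}"
  using diagram_col_set[of j \<alpha>] fillingD[OF assms]
  by (simp add: column_eq distinct_map del: set_filter set_upt upt_Suc)

text \<open>A column height depends only on the multiset of parts, hence survives sorting. Column 0
  is excluded: it has no cells, although every part is at least 0.\<close>

lemma card_diagram_col:
  assumes "1 \<le> j"
  shows "card {i. (i, j) \<in> diagram \<alpha>} = size (filter_mset (\<lambda>x. j \<le> x) (mset \<alpha>))"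
proof -
  have "{i. (i, j) \<in> diagram \<alpha>} = Suc ` {i. i < length \<alpha> \<and> j \<le> \<alpha> ! i}"
  proof (intro equalityI subsetI)
    fix i assume "i \<in> {i. (i, j) \<in> diagram \<alpha>}"
    thus "i \<in> Suc ` {i. i < length \<alpha> \<and> j \<le> \<alpha> ! i}"
      by (intro image_eqI[of _ _ "i - 1"]) (auto simp: diagram_def)
  qed (use assms in \<open>auto simp: diagram_def\<close>)
  hence "card {i. (i, j) \<in> diagram \<alpha>} = length (filter (\<lambda>x. j \<le> x) \<alpha>)"
    by (simp add: card_image length_filter_conv_card)
  thus ?thesis by (metis mset_filter size_mset)
qed

lemma mset_dsort [simp]: "mset (dsort xs) = mset xs"
  by (simp add: dsort_def)

lemma sum_list_dsort: "sum_list (dsort xs) = sum_list xs"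
  by (metis mset_dsort sum_mset_sum_list)

lemma length_dsort [simp]: "length (dsort xs) = length xs"
  by (simp add: dsort_def)

lemma card_diagram_col_dsort:
  "card {i. (i, j) \<in> diagram (dsort \<alpha>)} = card {i. (i, j) \<in> diagram \<alpha>}"
proof (cases "1 \<le> j")
  case False thus ?thesis by (simp add: diagram_def)
qed (simp add: card_diagram_col)

lemma partition_col:
  assumes "is_partition lam"
  shows "{i. (i, j) \<in> diagram lam} = {1..card {i. (i, j) \<in> diagram lam}}"
proof (rule down_closed_eq_atLeastAtMost)
  fix i k assume "i \<in> {i. (i, j) \<in> diagram lam}" "1 \<le> k" "k \<le> i"
  moreover from this have "lam ! (i - 1) \<le> lam ! (k - 1)"
    using assms sorted_wrt_nth_less[of "(\<ge>)" lam "k - 1" "i - 1"]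
    by (cases "k = i") (auto simp: diagram_def is_partition_def)
  ultimately show "k \<in> {i. (i, j) \<in> diagram lam}" by (auto simp: diagram_def)
qed (auto simp: diagram_def)

text \<open>A cell without an entry has value 0, so the inequality holds there for free and
  neighbouring columns suffice. It starts at column 1 because column 0 holds only zeros.\<close>

lemma rows_weakly_decrease_iff:
  assumes "is_filling \<alpha> \<tau>"
  shows "rows_weakly_decrease \<alpha> \<tau> \<longleftrightarrow> (\<forall>i j. 1 \<le> j \<longrightarrow> \<tau> (i, Suc j) \<le> \<tau> (i, j))"
    (is "?L \<longleftrightarrow> ?R")
proof
  assume L: ?L
  show ?R
  proof (intro allI impI)
    fix i j :: nat assume j: "1 \<le> j"
    show "\<tau> (i, Suc j) \<le> \<tau> (i, j)"
    proof (cases "(i, Suc j) \<in> diagram \<alpha>")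
      case True
      moreover from this j have "(i, j) \<in> diagram \<alpha>" by (auto simp: diagram_def)
      ultimately show ?thesis using L by (auto simp: rows_weakly_decrease_def)
    next
      case False
      hence "\<tau> (i, Suc j) = 0" using fillingD[OF assms] by metis
      thus ?thesis by simp
    qed
  qed
next
  assume R: ?R
  have "\<tau> (i, k) \<le> \<tau> (i, j)" if "1 \<le> j" "j \<le> k" for i j k
    using that(2)
  proof (induction k rule: dec_induct)
    case (step n)
    thus ?case using R that(1) by (meson dual_order.trans)
  qed simp
  thus ?L by (auto simp: rows_weakly_decrease_def diagram_def)
qed

lemma row_le:
  assumes "is_filling \<alpha> \<tau>" "rows_weakly_decrease \<alpha> \<tau>" "1 \<le> j" "j \<le> k"
  shows "\<tau> (i, k) \<le> \<tau> (i, j)"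
  using assms(4,3)
proof (induction k rule: dec_induct)
  case (step n)
  thus ?case using assms(1,2) by (metis dual_order.trans rows_weakly_decrease_iff)
qed simp

text \<open>The value 0 for a missing cell absorbs both existence claims: an entry that is at least
  a positive one, or exceeds another, belongs to a cell of the diagram.\<close>

lemma triple_condition_iff:
  assumes "is_filling \<alpha> \<tau>"
  shows "triple_condition \<alpha> \<tau> \<longleftrightarrow>
    (\<forall>i r j. 1 \<le> j \<and> i < r \<and> \<tau> (r, Suc j) \<noteq> 0 \<and> \<tau> (r, Suc j) \<le> \<tau> (i, j)
      \<longrightarrow> \<tau> (r, Suc j) < \<tau> (i, Suc j))" (is "?L \<longleftrightarrow> ?R")
proof
  assume ?L
  show ?R
  proof (intro allI impI, elim conjE)
    fix i r j assume a: "1 \<le> j" "i < r" "\<tau> (r, Suc j) \<noteq> 0" "\<tau> (r, Suc j) \<le> \<tau> (i, j)"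
    have "(i, j) \<in> diagram \<alpha>" using a fillingD[OF assms, of "(i, j)"] by auto
    moreover have "(r, j + 1) \<in> diagram \<alpha>" using a fillingD[OF assms, of "(r, Suc j)"] by simp
    ultimately show "\<tau> (r, Suc j) < \<tau> (i, Suc j)"
      using \<open>?L\<close> a unfolding triple_condition_def by simp
  qed
next
  assume R: ?R
  show ?L unfolding triple_condition_def
  proof (intro allI impI, elim conjE)
    fix i r j assume a: "i < r" "(i, j) \<in> diagram \<alpha>" "(r, j + 1) \<in> diagram \<alpha>"
      "\<tau> (r, j + 1) \<le> \<tau> (i, j)"
    have "\<tau> (r, Suc j) \<noteq> 0" using a fillingD[OF assms, of "(r, Suc j)"] by simp
    moreover have "1 \<le> j" using a by (auto simp: diagram_def)
    ultimately have "\<tau> (r, Suc j) < \<tau> (i, Suc j)" using R a by simp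
    thus "(i, j + 1) \<in> diagram \<alpha> \<and> \<tau> (r, j + 1) < \<tau> (i, j + 1)"
      using fillingD[OF assms, of "(i, Suc j)"] by simp
  qed
qed

text \<open>Distinctness is imposed on the first column only. Further right, equal entries in rows i
  < r would make the left neighbour in row i at least the entry in row r, and the triple condition
  would make the two entries differ.\<close>

lemma PCT_column_inj:
  assumes "is_PCT \<sigma> \<alpha> \<tau>"
  shows "inj_on (\<lambda>i. \<tau> (i, j)) {i. \<tau> (i, j) \<noteq> 0}"
proof -
  have fil: "is_filling \<alpha> \<tau>" and rw: "rows_weakly_decrease \<alpha> \<tau>" and tr: "triple_condition \<alpha> \<tau>"
    using assms by (auto simp: is_PCT_def)
  consider "j = 0" | "j = 1" | m where "j = Suc m" "1 \<le> m"
    by (metis One_nat_def Suc_leI not0_implies_Suc not_gr_zero)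
  thus ?thesis
  proof cases
    case 1
    hence "{i. \<tau> (i, j) \<noteq> 0} = {}" using fillingD[OF fil] by (auto simp: diagram_def)
    thus ?thesis by simp
  next
    case 2
    thus ?thesis using assms distinct_column[OF fil] by (simp add: is_PCT_def)
  next
    case 3
    have "\<tau> (i, j) \<noteq> \<tau> (r, j)" if "i < r" "\<tau> (r, j) \<noteq> 0" for i r
    proof
      assume eq: "\<tau> (i, j) = \<tau> (r, j)"
      hence "\<tau> (r, Suc m) \<le> \<tau> (i, m)" using row_le[OF fil rw 3(2), of j i] 3 by simp
      hence "\<tau> (r, Suc m) < \<tau> (i, Suc m)"
        using tr that 3 unfolding triple_condition_iff[OF fil] by blast
      thus False using eq 3 by simp
    qed
    thus ?thesis by (intro linorder_inj_onI') auto
  qed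
qed

lemma finite_colset: "is_filling \<alpha> \<tau> \<Longrightarrow> finite (colset \<tau> j)"
  by (metis List.finite_set set_column)

lemma card_colset:
  assumes "is_filling \<alpha> \<tau>" "inj_on (\<lambda>i. \<tau> (i, j)) {i. \<tau> (i, j) \<noteq> 0}"
  shows "card (colset \<tau> j) = card {i. (i, j) \<in> diagram \<alpha>}"
  using card_image[OF assms(2)] fillingD[OF assms(1)] by (simp add: colset_def)

lemma RT_column_inj:
  assumes "is_reverse_tableau lam T"
  shows "inj_on (\<lambda>i. T (i, j)) {i. T (i, j) \<noteq> 0}"
proof (intro linorder_inj_onI')
  have fil: "is_filling lam T" using assms by (simp add: is_reverse_tableau_def)
  fix i r assume "i \<in> {i. T (i, j) \<noteq> 0}" "r \<in> {i. T (i, j) \<noteq> 0}" "i < r"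
  hence "T (r, j) < T (i, j)"
    using assms fillingD[OF fil]
    unfolding is_reverse_tableau_def columns_strictly_decrease_def by blast
  thus "T (i, j) \<noteq> T (r, j)" by simp
qed

text \<open>A column of a partition shape has no gaps and strictly decreases, so its set of entries
  determines it. Equality of column sets thus becomes equality of reverse tableaux.\<close>

lemma RT_column_desc:
  assumes "is_partition lam" "is_reverse_tableau lam T" "(i, j) \<in> diagram lam"
  shows "T (i, j) = desc (colset T j) ! (i - 1)"
proof -
  have fil: "is_filling lam T" using assms by (simp add: is_reverse_tableau_def)
  define m where "m = card {i. (i, j) \<in> diagram lam}"
  have D: "{i. (i, j) \<in> diagram lam} = {1..m}"
    using partition_col[OF assms(1)] by (simp add: m_def)
  have D': "(a, j) \<in> diagram lam \<longleftrightarrow> 1 \<le> a \<and> a \<le> m" for a using D by auto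
  let ?xs = "map (\<lambda>i. T (i, j)) [1..<Suc m]"
  have "sorted_wrt (>) ?xs"
    using assms(2) D' by (auto simp: sorted_wrt_iff_nth_less is_reverse_tableau_def
        columns_strictly_decrease_def simp del: upt_Suc)
  hence "?xs = desc (set ?xs)" by (rule sorted_wrt_greater_eq_desc)
  also have "set ?xs = colset T j"
    using D fillingD[OF fil] by (auto simp: colset_def)
  finally have "desc (colset T j) ! (i - 1) = ?xs ! (i - 1)" by simp
  also have "\<dots> = T (i, j)" using assms(3) D' by (auto simp: nth_append simp del: upt_Suc)
  finally show ?thesis by simp
qed

section \<open>The map \<open>Psi\<close>\<close>

lemma dsort_column:
  assumes "is_PCT \<sigma> \<alpha> \<tau>"
  shows "dsort (column \<alpha> \<tau> j) = desc (colset \<tau> j)"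
proof -
  have fil: "is_filling \<alpha> \<tau>" using assms by (simp add: is_PCT_def)
  have "distinct (column \<alpha> \<tau> j)"
    unfolding distinct_column[OF fil] by (rule PCT_column_inj[OF assms])
  thus ?thesis by (simp add: dsort_distinct set_column[OF fil])
qed

lemma Psi_apply:
  assumes "is_PCT \<sigma> \<alpha> \<tau>"
  shows "Psi (\<alpha>, \<tau>) (i, j) =
    (if (i, j) \<in> diagram (dsort \<alpha>) then desc (colset \<tau> j) ! (i - 1) else 0)"
  by (simp add: Psi_def dsort_column[OF assms])

lemma card_colset_PCT:
  assumes "is_PCT \<sigma> \<alpha> \<tau>"
  shows "card (colset \<tau> j) = card {i. (i, j) \<in> diagram (dsort \<alpha>)}"
  using assms card_colset[OF _ PCT_column_inj[OF assms]]
  by (simp add: card_diagram_col_dsort is_PCT_def)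

lemma diagram_partition_iff:
  assumes "is_partition lam"
  shows "(i, j) \<in> diagram lam \<longleftrightarrow> 1 \<le> i \<and> i \<le> card {i. (i, j) \<in> diagram lam}"
proof -
  have "i \<in> {i. (i, j) \<in> diagram lam} \<longleftrightarrow> i \<in> {1..card {i. (i, j) \<in> diagram lam}}"
    by (subst partition_col[OF assms]) (rule refl)
  thus ?thesis by simp
qed

text \<open>A row whose entry in column k reaches x also reaches x in the earlier column j. The
  counting condition is needed for composition tableaux (rows of \<open>Psi\<close>) and for reverse
  tableaux (existence of the next column).\<close>

lemma card_colset_ge_mono:
  assumes fil: "is_filling \<alpha> \<tau>" and rw: "rows_weakly_decrease \<alpha> \<tau>"
    and inj: "\<And>j. inj_on (\<lambda>i. \<tau> (i, j)) {i. \<tau> (i, j) \<noteq> 0}"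
    and jk: "1 \<le> j" "j \<le> k" and x: "0 < x"
  shows "card {b \<in> colset \<tau> k. x \<le> b} \<le> card {a \<in> colset \<tau> j. x \<le> a}"
proof -
  have "{i. x \<le> \<tau> (i, j)} \<subseteq> {i. (i, j) \<in> diagram \<alpha>}"
  proof
    fix i assume "i \<in> {i. x \<le> \<tau> (i, j)}"
    thus "i \<in> {i. (i, j) \<in> diagram \<alpha>}" using fillingD[OF fil, of "(i, j)"] x by simp
  qed
  hence fin: "finite {i. x \<le> \<tau> (i, j)}" by (rule finite_subset) simp
  have "card {b \<in> colset \<tau> k. x \<le> b} = card {i. x \<le> \<tau> (i, k)}"
    unfolding colset_def by (rule card_image_ge[OF inj x])
  also have "\<dots> \<le> card {i. x \<le> \<tau> (i, j)}"
    using row_le[OF fil rw jk] by (intro card_mono fin Collect_mono) (meson order_trans impI)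
  also have "\<dots> = card {a \<in> colset \<tau> j. x \<le> a}"
    unfolding colset_def by (rule card_image_ge[OF inj x, symmetric])
  finally show ?thesis .
qed

lemma diagram_PCT_iff:
  assumes "is_PCT \<sigma> \<alpha> \<tau>" "is_partition (dsort \<alpha>)"
  shows "(i, j) \<in> diagram (dsort \<alpha>) \<longleftrightarrow> 1 \<le> i \<and> i \<le> card (colset \<tau> j)"
  using diagram_partition_iff[OF assms(2), of i j] card_colset_PCT[OF assms(1)] by simp

lemma Psi_filling:
  assumes "is_PCT \<sigma> \<alpha> \<tau>" "is_partition (dsort \<alpha>)"
  shows "is_filling (dsort \<alpha>) (Psi (\<alpha>, \<tau>))"
  unfolding is_filling_def
proof
  have fil: "is_filling \<alpha> \<tau>" using assms by (auto simp: is_PCT_def)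
  fix c :: "nat \<times> nat" obtain i j where c: "c = (i, j)" by force
  have "desc (colset \<tau> j) ! (i - 1) \<in> colset \<tau> j" if "(i, j) \<in> diagram (dsort \<alpha>)"
  proof -
    have "i - 1 < card (colset \<tau> j)" using that diagram_PCT_iff[OF assms, of i j] by linarith
    thus ?thesis using finite_colset[OF fil] nth_mem[of "i - 1" "desc (colset \<tau> j)"] by simp
  qed
  moreover note zero_notin_colset[of \<tau> j]
  ultimately show "0 < Psi (\<alpha>, \<tau>) c \<longleftrightarrow> c \<in> diagram (dsort \<alpha>)"
    by (auto simp: c Psi_apply[OF assms(1)] intro: gr0I)
qed

lemma colset_Psi:
  assumes "is_PCT \<sigma> \<alpha> \<tau>" "is_partition (dsort \<alpha>)"
  shows "colset (Psi (\<alpha>, \<tau>)) j = colset \<tau> j"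
proof -
  have fil: "is_filling \<alpha> \<tau>" using assms by (auto simp: is_PCT_def)
  have "{i. Psi (\<alpha>, \<tau>) (i, j) \<noteq> 0} = {i. (i, j) \<in> diagram (dsort \<alpha>)}"
    using Psi_filling[OF assms] fillingD by blast
  \<comment> \<open>Rows are numbered from 1, list positions from 0; the shift lets the column be
    read as the whole list \<open>desc (colset \<tau> j)\<close>.\<close>
  also have "\<dots> = Suc ` {..<card (colset \<tau> j)}"
    using partition_col[OF assms(2), of j] card_colset_PCT[OF assms(1)]
    by (simp add: image_Suc_lessThan)
  finally have "colset (Psi (\<alpha>, \<tau>)) j = (\<lambda>i. Psi (\<alpha>, \<tau>) (Suc i, j)) ` {..<card (colset \<tau> j)}"
    by (simp add: colset_def[of "Psi _"] image_image)
  also have "\<dots> = (\<lambda>i. desc (colset \<tau> j) ! i) ` {..<card (colset \<tau> j)}"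
    by (rule image_cong)
      (simp_all add: Psi_apply[OF assms(1)] diagram_PCT_iff[OF assms])
  also have "\<dots> = set (desc (colset \<tau> j))"
    by (simp add: set_conv_nth image_def lessThan_def Bex_def) blast
  finally show ?thesis using finite_colset[OF fil] by simp
qed

lemma Psi_reverse_tableau:
  assumes "is_PCT \<sigma> \<alpha> \<tau>" "is_partition (dsort \<alpha>)"
  shows "is_reverse_tableau (dsort \<alpha>) (Psi (\<alpha>, \<tau>))"
proof -
  have fil: "is_filling \<alpha> \<tau>" using assms by (auto simp: is_PCT_def)
  note fin = finite_colset[OF fil]
  note iff = diagram_PCT_iff[OF assms]
  note Psi_filling[OF assms]
  moreover have "columns_strictly_decrease (dsort \<alpha>) (Psi (\<alpha>, \<tau>))"
    unfolding columns_strictly_decrease_def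
  proof (intro allI impI, elim conjE)
    fix i r j assume a: "(i, j) \<in> diagram (dsort \<alpha>)" "(r, j) \<in> diagram (dsort \<alpha>)" "i < r"
    show "Psi (\<alpha>, \<tau>) (r, j) < Psi (\<alpha>, \<tau>) (i, j)"
      using a iff[of i j] iff[of r j]
        sorted_wrt_nth_less[OF sorted_wrt_desc, of "i - 1" "r - 1" "colset \<tau> j"]
      by (simp add: Psi_apply[OF assms(1)])
  qed
  moreover have "rows_weakly_decrease (dsort \<alpha>) (Psi (\<alpha>, \<tau>))"
    unfolding rows_weakly_decrease_def
  proof (intro allI impI, elim conjE)
    fix i j k assume a: "(i, j) \<in> diagram (dsort \<alpha>)" "(i, k) \<in> diagram (dsort \<alpha>)" "j < k"
    have "1 \<le> j" using a by (simp add: diagram_def)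
    \<comment> \<open>Sorting destroys the rows of \<tau>, so the comparison goes through the
      numbers of entries above each threshold.\<close>
    have "i - 1 < card (colset \<tau> j) \<and>
        desc (colset \<tau> k) ! (i - 1) \<le> desc (colset \<tau> j) ! (i - 1)"
    proof (rule desc_nth_le[OF fin fin])
      show "i - 1 < card (colset \<tau> k)" using a(2) iff[of i k] by linarith
      fix x assume "x \<in> colset \<tau> k"
      hence "0 < x" using zero_notin_colset by (metis not_gr_zero)
      thus "card {b \<in> colset \<tau> k. x \<le> b} \<le> card {a \<in> colset \<tau> j. x \<le> a}"
        using card_colset_ge_mono[OF fil _ PCT_column_inj[OF assms(1)] \<open>1 \<le> j\<close>] a(3) assms(1)
        by (simp add: is_PCT_def)
    qed
    thus "Psi (\<alpha>, \<tau>) (i, k) \<le> Psi (\<alpha>, \<tau>) (i, j)" using a by (simp add: Psi_apply[OF assms(1)])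
  qed
  ultimately show ?thesis by (simp add: is_reverse_tableau_def)
qed

lemma Psi_in_RT:
  assumes "is_partition lam" "x \<in> PCT_coproduct \<sigma> lam"
  shows "Psi x \<in> RT lam"
proof -
  obtain \<alpha> \<tau> where x: "x = (\<alpha>, \<tau>)" and lam: "lam = dsort \<alpha>" and pct: "is_PCT \<sigma> \<alpha> \<tau>"
    and bound: "\<And>c. c \<in> diagram \<alpha> \<Longrightarrow> \<tau> c \<le> sum_list \<alpha>"
    using assms(2) by (auto simp: PCT_coproduct_def PCT_def)
  have fil: "is_filling \<alpha> \<tau>" using pct by (auto simp: is_PCT_def)
  have rt: "is_reverse_tableau lam (Psi x)"
    using Psi_reverse_tableau[OF pct] assms lam x by simp
  have "Psi x c \<le> sum_list lam" if "c \<in> diagram lam" for c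
  proof -
    obtain i j where c: "c = (i, j)" by force
    have "Psi x (i, j) \<noteq> 0" using rt that c fillingD by (metis is_reverse_tableau_def)
    hence "Psi x (i, j) \<in> colset (Psi x) j" by (auto simp: colset_def)
    \<comment> \<open>Sorting moves entries only within their column, so the bound on \<tau> carries
      over; the sum of the parts is unchanged.\<close>
    hence "Psi x c \<in> colset \<tau> j" using colset_Psi[OF pct] assms lam x c by simp
    then obtain r where "Psi x c = \<tau> (r, j)" "\<tau> (r, j) \<noteq> 0" by (auto simp: colset_def)
    thus ?thesis using bound[of "(r, j)"] fillingD[OF fil] lam by (simp add: sum_list_dsort)
  qed
  thus ?thesis using rt by (simp add: RT_def)
qed

section \<open>Recovering a tableau from its columns\<close>

text \<open>The state of the algorithm when the columns before \<open>k\<close> are complete and the entries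
  in \<open>D\<close> have been placed in column \<open>k\<close>.\<close>

definition upto_column :: "filling \<Rightarrow> nat \<Rightarrow> nat set \<Rightarrow> filling" where
  "upto_column \<tau> k D = (\<lambda>(i, j). if j < k \<or> j = k \<and> \<tau> (i, j) \<in> D then \<tau> (i, j) else 0)"

text \<open>D holds the entries placed before x, namely those exceeding x. The row r of x in \<tau>
  is free and admits x because rows decrease. By the triple condition every higher row admitting x
  already holds a larger entry, so the least admissible row is r.\<close>

lemma place_upto_column:
  assumes pct: "is_PCT \<sigma> \<alpha> \<tau>" and k: "1 \<le> k"
    and x: "x \<in> colset \<tau> (Suc k)"
    and D: "\<And>y. y \<in> colset \<tau> (Suc k) \<Longrightarrow> y \<in> D \<longleftrightarrow> x < y"
  shows "place (Suc k) x (upto_column \<tau> (Suc k) D) = upto_column \<tau> (Suc k) (insert x D)"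
proof -
  have fil: "is_filling \<alpha> \<tau>" and rw: "rows_weakly_decrease \<alpha> \<tau>" and tr: "triple_condition \<alpha> \<tau>"
    using pct by (auto simp: is_PCT_def)
  let ?t = "upto_column \<tau> (Suc k) D"
  obtain r where r: "\<tau> (r, Suc k) = x" and x0: "x \<noteq> 0" using x by (auto simp: colset_def)
  \<comment> \<open>A cell of the current column looks filled exactly when its entry in \<tau>
    exceeds x.\<close>
  have new: "?t (i, Suc k) = (if x < \<tau> (i, Suc k) then \<tau> (i, Suc k) else 0)" for i
  proof (cases "\<tau> (i, Suc k) = 0")
    case False
    hence "\<tau> (i, Suc k) \<in> colset \<tau> (Suc k)" by (auto simp: colset_def)
    from D[OF this] show ?thesis by (simp add: upto_column_def)
  qed (simp add: upto_column_def)
  have old: "?t (i, Suc k - 1) = \<tau> (i, k)" for i by (simp add: upto_column_def)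
  have least: "(LEAST i. ?t (i, Suc k) = 0 \<and> ?t (i, Suc k - 1) \<noteq> 0 \<and> x \<le> ?t (i, Suc k - 1)) = r"
    unfolding old
  proof (rule Least_equality)
    show "?t (r, Suc k) = 0 \<and> \<tau> (r, k) \<noteq> 0 \<and> x \<le> \<tau> (r, k)"
      using row_le[OF fil rw k, of "Suc k" r] r x0 by (auto simp: new)
    fix i assume i: "?t (i, Suc k) = 0 \<and> \<tau> (i, k) \<noteq> 0 \<and> x \<le> \<tau> (i, k)"
    show "r \<le> i"
    proof (rule ccontr)
      assume "\<not> r \<le> i"
      hence "x < \<tau> (i, Suc k)"
        using tr i r x0 k unfolding triple_condition_iff[OF fil] by (metis not_le)
      thus False using i by (simp add: new)
    qed
  qed
  \<comment> \<open>Entries of the column are distinct, so adding x to D uncovers one cell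
    only.\<close>
  have inj: "\<tau> (i, Suc k) = x \<longleftrightarrow> i = r" for i
    using inj_onD[OF PCT_column_inj[OF pct, of "Suc k"], of i r] r x0 by auto
  have "?t((r, Suc k) := x) = upto_column \<tau> (Suc k) (insert x D)"
  proof
    fix c :: "nat \<times> nat" obtain i j where c: "c = (i, j)" by force
    show "(?t((r, Suc k) := x)) c = upto_column \<tau> (Suc k) (insert x D) c"
      by (cases "j = Suc k") (auto simp: c upto_column_def inj r)
  qed
  thus ?thesis unfolding place_def least by simp
qed

text \<open>The induction moves entries from the pending list to D; since all pending entries stay
  below all placed ones, D is always the set of entries exceeding the next one.\<close>

lemma fold_place_upto_column:
  assumes pct: "is_PCT \<sigma> \<alpha> \<tau>" and k: "1 \<le> k"
    and "sorted_wrt (>) ys" "set ys \<union> D = colset \<tau> (Suc k)"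
    and "\<And>x y. x \<in> set ys \<Longrightarrow> y \<in> D \<Longrightarrow> x < y"
  shows "fold (place (Suc k)) ys (upto_column \<tau> (Suc k) D) =
    upto_column \<tau> (Suc k) (colset \<tau> (Suc k))"
  using assms(3-5)
proof (induction ys arbitrary: D)
  case (Cons x ys)
  have "place (Suc k) x (upto_column \<tau> (Suc k) D) = upto_column \<tau> (Suc k) (insert x D)"
  proof (rule place_upto_column[OF pct k])
    show "x \<in> colset \<tau> (Suc k)" using Cons.prems(2) by auto
    fix y assume "y \<in> colset \<tau> (Suc k)"
    hence "y = x \<or> y \<in> set ys \<or> y \<in> D" using Cons.prems(2) by auto
    moreover have "z < x" if "z \<in> set ys" for z using Cons.prems(1) that by simp
    moreover have "z < w" if "z \<in> set (x # ys)" "w \<in> D" for z w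
      using Cons.prems(3) that by blast
    ultimately show "y \<in> D \<longleftrightarrow> x < y" by (metis less_asym list.set_intros less_irrefl)
  qed
  moreover have "fold (place (Suc k)) ys (upto_column \<tau> (Suc k) (insert x D)) =
      upto_column \<tau> (Suc k) (colset \<tau> (Suc k))"
    by (rule Cons.IH) (use Cons.prems in auto)
  ultimately show ?case by simp
qed (simp add: upto_column_def)

lemma fold_place_column:
  assumes pct: "is_PCT \<sigma> \<alpha> \<tau>" and k: "1 \<le> k"
  shows "fold (place (Suc k)) (desc (colset \<tau> (Suc k))) (upto_column \<tau> (Suc k) {}) =
    upto_column \<tau> (Suc (Suc k)) {}"
proof -
  have fil: "is_filling \<alpha> \<tau>" using pct by (auto simp: is_PCT_def)
  have "fold (place (Suc k)) (desc (colset \<tau> (Suc k))) (upto_column \<tau> (Suc k) {}) =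
    upto_column \<tau> (Suc k) (colset \<tau> (Suc k))"
    by (rule fold_place_upto_column[OF pct k sorted_wrt_desc])
      (simp_all add: finite_colset[OF fil])
  \<comment> \<open>A column shown in full is the same state as the following column not yet
    begun.\<close>
  also have "\<dots> = upto_column \<tau> (Suc (Suc k)) {}"
    by (rule ext) (auto simp: upto_column_def colset_def less_Suc_eq)
  finally show ?thesis .
qed

text \<open>\<open>L\<close> stays abstract because the algorithm takes its lists from the reverse
  tableau, which shares with \<tau> only the column sets.\<close>

lemma fold_columns:
  assumes pct: "is_PCT \<sigma> \<alpha> \<tau>"
    and L: "\<And>k. L k = desc (colset \<tau> k)"
  shows "fold (\<lambda>k. fold (place k) (L k)) [2..<Suc (Suc m)] (upto_column \<tau> 2 {}) =
    upto_column \<tau> (Suc (Suc m)) {}"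
proof (induction m)
  case 0
  show ?case by (simp add: numeral_2_eq_2)
next
  case (Suc m)
  have "[2..<Suc (Suc (Suc m))] = [2..<Suc (Suc m)] @ [Suc (Suc m)]" by simp
  thus ?case using Suc.IH fold_place_column[OF pct, of "Suc m"] by (simp add: L del: upt_Suc)
qed

section \<open>Standardization of distinct words\<close>

text \<open>Gives the standardization of a distinct word in closed form. Counting with
  \<open>\<le>\<close> makes the ranks of the elements of A start at 1.\<close>

definition rank :: "nat set \<Rightarrow> nat \<Rightarrow> nat" where
  "rank A a = card {b \<in> A. b \<le> a}"

lemma rank_strict_mono:
  assumes "finite A" "b \<in> A" "a < b"
  shows "rank A a < rank A b"
  unfolding rank_def
proof (rule psubset_card_mono)
  have "b \<in> {x \<in> A. x \<le> b} - {x \<in> A. x \<le> a}" using assms by simp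
  moreover have "{x \<in> A. x \<le> a} \<subseteq> {x \<in> A. x \<le> b}" using assms by auto
  ultimately show "{x \<in> A. x \<le> a} \<subset> {x \<in> A. x \<le> b}" by blast
qed (use assms in simp)

lemma rank_less_iff: "\<lbrakk>finite A; a \<in> A; b \<in> A\<rbrakk> \<Longrightarrow> rank A a < rank A b \<longleftrightarrow> a < b"
  using rank_strict_mono by (metis less_asym linorder_neqE_nat less_irrefl)

lemma rank_bij_betw:
  assumes "finite A"
  shows "bij_betw (rank A) A {1..card A}"
proof -
  have inj: "inj_on (rank A) A"
    using rank_strict_mono[OF assms] by (intro linorder_inj_onI') (metis less_irrefl)
  have "rank A a \<in> {1..card A}" if "a \<in> A" for a
  proof -
    have "card {a} \<le> rank A a"
      unfolding rank_def by (rule card_mono) (use assms that in auto)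
    moreover have "rank A a \<le> card A"
      unfolding rank_def by (rule card_mono) (use assms in auto)
    ultimately show ?thesis by simp
  qed
  hence "rank A ` A \<subseteq> {1..card A}" by auto
  moreover have "card (rank A ` A) = card A" using inj by (rule card_image)
  ultimately have "rank A ` A = {1..card A}" by (intro card_subset_eq) auto
  with inj show ?thesis by (simp add: bij_betw_def)
qed

lemma image_nth_pred: "(\<lambda>i. w ! (i - 1)) ` {1..length w} = set w"
proof -
  have "{1..length w} = Suc ` {..<length w}" by (simp add: image_Suc_lessThan)
  hence "(\<lambda>i. w ! (i - 1)) ` {1..length w} = (\<lambda>i. w ! i) ` {..<length w}"
    by (simp only: image_image diff_Suc_1)
  also have "\<dots> = set w" by (auto simp: set_conv_nth)
  finally show ?thesis .
qed

lemma nth_pred_bij_betw: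
  assumes "distinct w"
  shows "bij_betw (\<lambda>i. w ! (i - 1)) {1..length w} (set w)"
proof -
  have "bij_betw ((!) w \<circ> (\<lambda>i. i - 1)) {1..length w} (set w)"
  proof (rule bij_betw_trans)
    show "bij_betw (\<lambda>i. i - 1) {1..length w} {..<length w}"
      by (rule bij_betw_byWitness[of _ Suc]) auto
    show "bij_betw ((!) w) {..<length w} (set w)"
      using assms by (rule bij_betw_nth) auto
  qed
  thus ?thesis by (simp add: o_def)
qed

text \<open>Resolves the description operator in \<open>stan\<close>. Ranks satisfy the
  specification; conversely, a permutation value is the number of values not exceeding it, and the
  specification converts that count into a count of letters.\<close>

lemma stan_distinct:
  assumes "distinct w"
  shows "stan w permutes {1..length w}"
    and "\<And>i. i \<in> {1..length w} \<Longrightarrow> stan w i = rank (set w) (w ! (i - 1))"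
proof -
  let ?N = "{1..length w}" and ?w = "\<lambda>i. w ! (i - 1)"
  let ?P = "\<lambda>\<pi>. \<pi> permutes ?N \<and>
    (\<forall>i j. 1 \<le> i \<and> i < j \<and> j \<le> length w \<longrightarrow> (\<pi> i > \<pi> j \<longleftrightarrow> ?w i > ?w j))"
  \<comment> \<open>Outside the positions the identity is forced by \<open>permutes\<close>.\<close>
  define \<rho> where "\<rho> i = (if i \<in> ?N then rank (set w) (?w i) else i)" for i
  have card: "card (set w) = length w" using assms by (rule distinct_card)
  have bij: "bij_betw ?w ?N (set w)" by (rule nth_pred_bij_betw[OF assms])
  have mem: "?w i \<in> set w" if "i \<in> ?N" for i using bij that by (rule bij_betwE[rule_format])
  have "bij_betw (rank (set w) \<circ> ?w) ?N ?N"
    using bij_betw_trans[OF bij rank_bij_betw[of "set w"]] card by simp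
  hence "bij_betw \<rho> ?N ?N" by (rule bij_betw_cong[THEN iffD1, rotated]) (simp add: \<rho>_def)
  hence "\<rho> permutes ?N" by (rule bij_imp_permutes) (auto simp: \<rho>_def)
  moreover have "\<rho> i > \<rho> j \<longleftrightarrow> ?w i > ?w j" if "1 \<le> i \<and> i < j \<and> j \<le> length w" for i j
    using that rank_less_iff[of "set w" "?w j" "?w i"] mem[of i] mem[of j] by (simp add: \<rho>_def)
  ultimately have P: "?P \<rho>" by blast
  have "\<pi> = \<rho>" if \<pi>: "?P \<pi>" for \<pi>
  proof
    fix i
    show "\<pi> i = \<rho> i"
    proof (cases "i \<in> ?N")
      case False
      thus ?thesis using \<pi> permutes_not_in[of \<pi> ?N i] by (auto simp: \<rho>_def)
    next
      case True
      have perm: "\<pi> permutes ?N" using \<pi> by blast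
      \<comment> \<open>The specification compares strictly and only for increasing positions;
        distinctness of letters and injectivity of \<pi> extend it to all pairs.\<close>
      have le: "\<pi> m \<le> \<pi> i \<longleftrightarrow> ?w m \<le> ?w i" if "m \<in> ?N" for m
      proof (cases m i rule: linorder_cases)
        case less
        have "\<pi> i < \<pi> m \<longleftrightarrow> ?w i < ?w m" using \<pi> less that True by simp
        thus ?thesis by linarith
      next
        case greater
        have "\<pi> m < \<pi> i \<longleftrightarrow> ?w m < ?w i" using \<pi> greater that True by simp
        moreover have "\<pi> m \<noteq> \<pi> i" using permutes_inj[OF perm] greater by (simp add: inj_eq)
        moreover have "?w m \<noteq> ?w i"
          using inj_onD[OF bij_betw_imp_inj_on[OF bij] _ that True] greater by blast
        ultimately show ?thesis by linarith
      qed simp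
      have "\<pi> i \<in> ?N" using permutes_in_image[OF perm] True by blast
      hence "{y \<in> ?N. y \<le> \<pi> i} = {1..\<pi> i}" by auto
      moreover have "\<pi> ` {m \<in> ?N. \<pi> m \<le> \<pi> i} = {y \<in> \<pi> ` ?N. y \<le> \<pi> i}" by blast
      ultimately have "\<pi> ` {m \<in> ?N. \<pi> m \<le> \<pi> i} = {1..\<pi> i}"
        by (simp only: permutes_image[OF perm])
      hence "\<pi> i = card (\<pi> ` {m \<in> ?N. \<pi> m \<le> \<pi> i})" by simp
      also have "\<dots> = card {m \<in> ?N. \<pi> m \<le> \<pi> i}"
        by (rule card_image, rule inj_on_subset[OF permutes_inj[OF perm]]) simp
      also have "{m \<in> ?N. \<pi> m \<le> \<pi> i} = {m \<in> ?N. ?w m \<le> ?w i}" using le by blast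
      also have "card \<dots> = card (?w ` {m \<in> ?N. ?w m \<le> ?w i})"
        by (rule card_image[symmetric], rule inj_on_subset[OF bij_betw_imp_inj_on[OF bij]]) blast
      also have "?w ` {m \<in> ?N. ?w m \<le> ?w i} = {b \<in> set w. b \<le> ?w i}"
        unfolding bij_betw_imp_surj_on[OF bij, symmetric] by blast
      finally show ?thesis using True by (simp add: \<rho>_def rank_def)
    qed
  qed
  hence "stan w = \<rho>" unfolding stan_def using P by (intro the_equality) blast+
  thus "stan w permutes ?N" "\<And>i. i \<in> ?N \<Longrightarrow> stan w i = rank (set w) (?w i)"
    using P by (simp_all add: \<rho>_def)
qed

lemma stan_eq_iff:
  assumes "distinct w" "\<sigma> permutes {1..length w}"
  shows "stan w = \<sigma> \<longleftrightarrow> (\<forall>i\<in>{1..length w}. rank (set w) (w ! (i - 1)) = \<sigma> i)"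
proof
  assume R: "\<forall>i\<in>{1..length w}. rank (set w) (w ! (i - 1)) = \<sigma> i"
  show "stan w = \<sigma>"
  proof
    fix i show "stan w i = \<sigma> i"
      using R stan_distinct(2)[OF assms(1), of i] permutes_not_in[OF assms(2), of i]
        permutes_not_in[OF stan_distinct(1)[OF assms(1)], of i]
      by (cases "i \<in> {1..length w}") auto
  qed
qed (use stan_distinct[OF assms(1)] in auto)

text \<open>The letter at position i must be the element of rank \<open>\<sigma> i\<close>, which
  fixes the word. This makes \<open>first_column_word\<close> well defined.\<close>

lemma ex1_word_stan:
  assumes "distinct L" "\<sigma> permutes {1..length L}"
  shows "\<exists>!w. mset w = mset L \<and> stan w = \<sigma>"
proof -
  define A where "A = set L"
  have A: "finite A" "card A = length L" using assms(1) by (simp_all add: A_def distinct_card)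
  have bij: "bij_betw (rank A) A {1..length L}" using rank_bij_betw[OF A(1)] A(2) by simp
  have char: "mset w = mset L \<and> stan w = \<sigma> \<longleftrightarrow> length w = length L \<and>
      (\<forall>i\<in>{1..length L}. w ! (i - 1) = inv_into A (rank A) (\<sigma> i))" (is "?l w \<longleftrightarrow> ?r w") for w
  proof
    assume l: "?l w"
    hence w: "length w = length L" "set w = A" "distinct w"
      using assms(1) by (auto simp: A_def dest: mset_eq_length mset_eq_setD mset_eq_imp_distinct_iff)
    have "w ! (i - 1) = inv_into A (rank A) (\<sigma> i)" if i: "i \<in> {1..length L}" for i
    proof -
      have "rank A (w ! (i - 1)) = \<sigma> i" using stan_distinct(2)[OF w(3), of i] w l i by simp
      moreover have "w ! (i - 1) \<in> A"
        using bij_betwE[OF nth_pred_bij_betw[OF w(3)]] w i by auto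
      ultimately show ?thesis using bij_betw_imp_inj_on[OF bij] by (metis inv_into_f_f)
    qed
    with w show "?r w" by blast
  next
    assume r: "?r w"
    have "bij_betw (inv_into A (rank A) \<circ> \<sigma>) {1..length L} A"
      using permutes_imp_bij[OF assms(2)] bij_betw_inv_into[OF bij] by (rule bij_betw_trans)
    hence bw: "bij_betw (\<lambda>i. w ! (i - 1)) {1..length L} A"
      by (rule bij_betw_cong[THEN iffD1, rotated]) (use r in auto)
    hence set: "set w = A" using bij_betw_imp_surj_on[OF bw] r image_nth_pred[of w] by simp
    hence dist: "distinct w" using A r by (intro card_distinct) simp
    have "mset w = mset L" using set dist assms(1) by (simp add: set_eq_iff_mset_eq_distinct A_def)
    moreover have "rank A (w ! (i - 1)) = \<sigma> i" if i: "i \<in> {1..length L}" for i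
      using r i permutes_in_image[OF assms(2)] bij_betw_inv_into_right[OF bij] by simp
    hence "stan w = \<sigma>" using stan_eq_iff[OF dist] assms(2) set r by simp
    ultimately show "?l w" ..
  qed
  show ?thesis unfolding char
  proof (rule ex1I[of _ "map (\<lambda>i. inv_into A (rank A) (\<sigma> i)) [1..<Suc (length L)]"])
    fix w assume "length w = length L \<and>
      (\<forall>i\<in>{1..length L}. w ! (i - 1) = inv_into A (rank A) (\<sigma> i))"
    thus "w = map (\<lambda>i. inv_into A (rank A) (\<sigma> i)) [1..<Suc (length L)]"
      by (intro nth_equalityI) (force simp del: upt_Suc)+
  qed (auto simp del: upt_Suc)
qed

lemma column_1_composition:
  assumes "is_composition \<alpha>"
  shows "column \<alpha> \<tau> 1 = map (\<lambda>i. \<tau> (i, 1)) [1..<Suc (length \<alpha>)]"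
proof -
  have "filter (\<lambda>i. (i, 1) \<in> diagram \<alpha>) [1..<Suc (length \<alpha>)] = [1..<Suc (length \<alpha>)]"
    using assms by (subst filter_id_conv) (auto simp: diagram_def is_composition_def Suc_le_eq)
  thus ?thesis by (simp add: column_eq)
qed

section \<open>Existence of a tableau with given columns\<close>

text \<open>The smallest entry is placed last, in the first free row that admits it.\<close>

lemma ex_next_column:
  fixes p :: "nat \<Rightarrow> nat"
  assumes fin: "finite {r. p r \<noteq> 0}" and "finite S" "0 \<notin> S"
    and "\<And>s. s \<in> S \<Longrightarrow> card {a \<in> S. s \<le> a} \<le> card {r. s \<le> p r}"
  shows "\<exists>q. (\<forall>r. q r \<le> p r) \<and> inj_on q {r. q r \<noteq> 0} \<and> q ` {r. q r \<noteq> 0} = S \<and>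
    (\<forall>i r. i < r \<and> q r \<noteq> 0 \<and> q r \<le> p i \<longrightarrow> q r < q i)"
  using assms(2-4)
proof (induction S rule: finite_linorder_min_induct)
  case empty
  show ?case by (rule exI[of _ "\<lambda>_. 0"]) simp
next
  case (insert b A)
  have "card {a \<in> A. s \<le> a} \<le> card {r. s \<le> p r}" if "s \<in> A" for s
  proof -
    have "{a \<in> insert b A. s \<le> a} = {a \<in> A. s \<le> a}" using insert.hyps that by force
    thus ?thesis using insert.prems(2)[of s] that by simp
  qed
  hence "\<exists>q. (\<forall>r. q r \<le> p r) \<and> inj_on q {r. q r \<noteq> 0} \<and> q ` {r. q r \<noteq> 0} = A \<and>
      (\<forall>i r. i < r \<and> q r \<noteq> 0 \<and> q r \<le> p i \<longrightarrow> q r < q i)"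
    using insert.IH insert.prems(1) by blast
  then obtain q where le: "\<And>r. q r \<le> p r" and inj: "inj_on q {r. q r \<noteq> 0}"
    and im: "q ` {r. q r \<noteq> 0} = A"
    and tr: "\<And>i r. i < r \<Longrightarrow> q r \<noteq> 0 \<Longrightarrow> q r \<le> p i \<Longrightarrow> q r < q i"
    by blast
  have b0: "b \<noteq> 0" and bA: "b \<notin> A" using insert by auto
  have "finite {r. b \<le> p r}" by (rule finite_subset[OF _ fin]) (use b0 in auto)
  have finq: "finite {r. q r \<noteq> 0}"
    by (rule finite_subset[OF _ fin]) (use le in \<open>auto simp: Suc_le_eq intro: less_le_trans\<close>)
  \<comment> \<open>At threshold b the hypothesis provides more rows admitting b than there are rows
    occupied by A, so one of them is free.\<close>
  have "{a \<in> insert b A. b \<le> a} = insert b A" using insert.hyps by force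
  hence "card (insert b A) \<le> card {r. b \<le> p r}" using insert.prems(2)[of b] by simp
  hence "card {r. q r \<noteq> 0} < card {r. b \<le> p r}"
    using card_image[OF inj] im insert.hyps(1) bA by simp
  hence "\<not> {r. b \<le> p r} \<subseteq> {r. q r \<noteq> 0}" using card_mono[OF finq] by (meson not_le)
  hence ex: "\<exists>r. q r = 0 \<and> b \<le> p r" by auto
  \<comment> \<open>The same choice as in \<open>place\<close>; a nonzero left neighbour is
    automatic because b is positive.\<close>
  define r0 where "r0 = (LEAST r. q r = 0 \<and> b \<le> p r)"
  have r0: "q r0 = 0" "b \<le> p r0" using LeastI_ex[OF ex] by (simp_all add: r0_def)
  have less_r0: "q i \<noteq> 0" if "i < r0" "b \<le> p i" for i
    using not_less_Least[of i "\<lambda>r. q r = 0 \<and> b \<le> p r"] that by (auto simp: r0_def)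
  have gt: "b < q i" if "q i \<noteq> 0" for i using insert.hyps(2) im that by blast
  let ?q = "q(r0 := b)"
  have supp: "{r. ?q r \<noteq> 0} = insert r0 {r. q r \<noteq> 0}" using b0 by auto
  have "\<forall>r. ?q r \<le> p r" using le r0 by simp
  moreover have "?q ` {r. ?q r \<noteq> 0} = insert b A" using im r0 unfolding supp by auto
  moreover have "inj_on ?q {r. ?q r \<noteq> 0}"
    using inj im bA r0 unfolding supp by (auto simp: inj_on_def)
  \<comment> \<open>For the new entry, rows above \<open>r0\<close> admitting b are occupied by
    larger entries. For an old entry with i = \<open>r0\<close>, the old triple condition would put
    it below \<open>q r0 = 0\<close>, which is impossible.\<close>
  moreover have "?q r < ?q i" if "i < r" "?q r \<noteq> 0" "?q r \<le> p i" for i r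
  proof (cases "r = r0")
    case True
    thus ?thesis using that less_r0[of i] gt[of i] by simp
  next
    case False
    thus ?thesis using that tr[of i r] r0 by (cases "i = r0") auto
  qed
  ultimately show ?case by blast
qed

text \<open>The multiplicity of j is the difference of the heights of columns j and j + 1: a
  partition is determined by its conjugate.\<close>

lemma mset_eq_if_size_ge_eq:
  fixes M N :: "nat multiset"
  assumes "0 \<notin># M" "0 \<notin># N"
    and "\<And>j. 1 \<le> j \<Longrightarrow> size (filter_mset (\<lambda>x. j \<le> x) M) = size (filter_mset (\<lambda>x. j \<le> x) N)"
  shows "M = N"
proof (rule multiset_eqI)
  have split: "size (filter_mset (\<lambda>x. j \<le> x) K) = count K j + size (filter_mset (\<lambda>x. Suc j \<le> x) K)"
    for K :: "nat multiset" and j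
    by (induction K) auto
  fix j show "count M j = count N j"
  proof (cases "j = 0")
    case True
    thus ?thesis using assms(1,2) by (simp add: not_in_iff)
  next
    case False
    thus ?thesis using split[of j M] split[of j N] assms(3)[of j] assms(3)[of "Suc j"] by simp
  qed
qed

lemma dsort_eq_partition:
  assumes "is_partition lam" "mset \<alpha> = mset lam"
  shows "dsort \<alpha> = lam"
proof -
  have "sort \<alpha> = rev lam"
    using assms by (intro properties_for_sort) (simp_all add: is_partition_def sorted_wrt_rev)
  thus ?thesis by (simp add: dsort_def)
qed

lemma first_column_word_spec:
  assumes "is_partition lam" "\<sigma> permutes {1..length lam}" "is_reverse_tableau lam T"
  shows "mset (first_column_word \<sigma> lam T) = mset (column lam T 1)"
    and "stan (first_column_word \<sigma> lam T) = \<sigma>"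
    and "\<And>w. mset w = mset (column lam T 1) \<Longrightarrow> stan w = \<sigma> \<Longrightarrow> first_column_word \<sigma> lam T = w"
proof -
  have fil: "is_filling lam T" using assms(3) by (simp add: is_reverse_tableau_def)
  have "distinct (column lam T 1)"
    unfolding distinct_column[OF fil] by (rule RT_column_inj[OF assms(3)])
  moreover have "length (column lam T 1) = length lam"
    using assms(1) by (subst column_1_composition) (simp_all add: is_partition_def del: upt_Suc)
  ultimately have ex1: "\<exists>!w. mset w = mset (column lam T 1) \<and> stan w = \<sigma>"
    using assms(2) by (intro ex1_word_stan) simp_all
  show "mset (first_column_word \<sigma> lam T) = mset (column lam T 1)"
    and "stan (first_column_word \<sigma> lam T) = \<sigma>"
    using theI'[OF ex1] by (simp_all add: first_column_word_def)
  show "first_column_word \<sigma> lam T = w" if "mset w = mset (column lam T 1)" "stan w = \<sigma>" for w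
    unfolding first_column_word_def using the1_equality[OF ex1] that by blast
qed

section \<open>The two inverse laws\<close>

lemma row_lengths_filling:
  assumes "is_filling \<alpha> \<tau>"
  shows "row_lengths (length \<alpha>) \<tau> = \<alpha>"
proof (rule nth_equalityI)
  fix i assume "i < length (row_lengths (length \<alpha>) \<tau>)"
  hence i: "i < length \<alpha>" by (simp add: row_lengths_def del: upt_Suc)
  have "{j. \<tau> (Suc i, j) \<noteq> 0} = {1..\<alpha> ! i}"
    using i fillingD[OF assms] by (auto simp: diagram_def)
  thus "row_lengths (length \<alpha>) \<tau> ! i = \<alpha> ! i"
    using i by (simp add: row_lengths_def del: upt_Suc)
qed (simp add: row_lengths_def del: upt_Suc)

lemma upto_column_all:
  assumes "is_filling \<alpha> \<tau>" "\<And>a. a \<in> set \<alpha> \<Longrightarrow> a < k"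
  shows "upto_column \<tau> k {} = \<tau>"
proof
  fix c :: "nat \<times> nat" obtain i j where c: "c = (i, j)" by force
  have "\<tau> (i, j) = 0" if "k \<le> j"
  proof (rule ccontr)
    assume "\<tau> (i, j) \<noteq> 0"
    hence "1 \<le> i" "i \<le> length \<alpha>" "j \<le> \<alpha> ! (i - 1)"
      using fillingD[OF assms(1)] by (auto simp: diagram_def)
    thus False using assms(2)[of "\<alpha> ! (i - 1)"] that by simp
  qed
  thus "upto_column \<tau> k {} c = \<tau> c" by (auto simp: c upto_column_def)
qed

lemma phi_bar_Psi:
  assumes "is_partition lam" "\<sigma> permutes {1..length lam}" "x \<in> PCT_coproduct \<sigma> lam"
  shows "phi_bar \<sigma> lam (Psi x) = x"
proof -
  obtain \<alpha> \<tau> where x: "x = (\<alpha>, \<tau>)" and comp: "is_composition \<alpha>" and lam: "dsort \<alpha> = lam"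
    and pct: "is_PCT \<sigma> \<alpha> \<tau>"
    using assms(3) by (auto simp: PCT_coproduct_def PCT_def)
  have fil: "is_filling \<alpha> \<tau>" using pct by (auto simp: is_PCT_def)
  have len: "length lam = length \<alpha>" and set: "set lam = set \<alpha>"
    using lam length_dsort[of \<alpha>] mset_dsort[of \<alpha>] by (auto dest: mset_eq_setD)
  define T where "T = Psi x"
  have rt: "is_reverse_tableau lam T"
    using Psi_reverse_tableau[OF pct] assms(1) by (simp add: T_def x lam)
  have filT: "is_filling lam T" using rt by (simp add: is_reverse_tableau_def)
  have cs: "colset T k = colset \<tau> k" for k
    using colset_Psi[OF pct] assms(1) by (simp add: T_def x lam)
  have distT: "distinct (column lam T k)" for k
    unfolding distinct_column[OF filT] by (rule RT_column_inj[OF rt])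
  \<comment> \<open>The two first columns have equal sets and no repetitions, hence equal multisets;
    the type then singles out the word.\<close>
  have word: "first_column_word \<sigma> lam T = column \<alpha> \<tau> 1"
  proof (rule first_column_word_spec(3)[OF assms(1,2) rt])
    show "mset (column \<alpha> \<tau> 1) = mset (column lam T 1)"
      using pct distT[of 1] set_column[OF fil] set_column[OF filT] cs
      by (simp add: set_eq_iff_mset_eq_distinct[symmetric] is_PCT_def)
    show "stan (column \<alpha> \<tau> 1) = \<sigma>" using pct by (simp add: is_PCT_def)
  qed
  have init: "initial_filling \<sigma> lam T = upto_column \<tau> 2 {}"
  proof
    fix c :: "nat \<times> nat" obtain i j where c: "c = (i, j)" by force
    have "\<tau> (i, j) = 0" if "j = 0 \<or> \<not> (1 \<le> i \<and> i \<le> length \<alpha>)"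
      using that fillingD[OF fil, of "(i, j)"] by (auto simp: diagram_def)
    moreover have "column \<alpha> \<tau> 1 ! (i - 1) = \<tau> (i, 1)" if "1 \<le> i \<and> i \<le> length \<alpha>"
      using that by (subst column_1_composition[OF comp]) (auto simp: nth_append simp del: upt_Suc)
    ultimately show "initial_filling \<sigma> lam T c = upto_column \<tau> 2 {} c"
      by (auto simp: initial_filling_def upto_column_def word c len less_2_cases_iff)
  qed
  have cols: "dsort (column lam T k) = desc (colset \<tau> k)" for k
    by (simp only: dsort_distinct[OF distT] set_column[OF filT] cs)
  have "phi_filling \<sigma> lam T = \<tau>"
  proof (cases lam)
    case Nil
    hence "phi_filling \<sigma> lam T = upto_column \<tau> 2 {}" unfolding phi_filling_def init by (simp add: Nil)
    also have "\<dots> = \<tau>" by (rule upto_column_all[OF fil]) (use set Nil in simp)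
    finally show ?thesis .
  next
    \<comment> \<open>The head is the largest part. Writing it as m + 1 makes the fold run over
      columns 2 to m + 1, and no cell of \<tau> lies beyond them.\<close>
    case (Cons l ls)
    then obtain m where m: "l = Suc m"
      using assms(1) by (cases l) (auto simp: is_partition_def is_composition_def)
    have "phi_filling \<sigma> lam T = fold (\<lambda>k. fold (place k) (dsort (column lam T k)))
        [2..<Suc (Suc m)] (upto_column \<tau> 2 {})"
      unfolding phi_filling_def init by (simp add: Cons m del: upt_Suc)
    also have "\<dots> = upto_column \<tau> (Suc (Suc m)) {}" by (rule fold_columns[OF pct cols])
    also have "\<dots> = \<tau>"
    proof (rule upto_column_all[OF fil])
      fix a assume "a \<in> set \<alpha>"
      thus "a < Suc (Suc m)"
        using assms(1) Cons m unfolding set[symmetric] by (auto simp: is_partition_def less_Suc_eq_le)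
    qed
    finally show ?thesis .
  qed
  thus ?thesis
    unfolding phi_bar_def T_def[symmetric] by (simp add: x len row_lengths_filling[OF fil])
qed

text \<open>The preimage is assembled from \<open>ex_next_column\<close> without running the
  algorithm; the left inverse law later identifies it with the output of
  \<open>phi_bar\<close>.\<close>

lemma Psi_surj:
  assumes "is_partition lam" "\<sigma> permutes {1..length lam}" "T \<in> RT lam"
  shows "\<exists>x \<in> PCT_coproduct \<sigma> lam. Psi x = T"
proof -
  define n where "n = length lam"
  have rt: "is_reverse_tableau lam T" and bound: "\<And>c. c \<in> diagram lam \<Longrightarrow> T c \<le> sum_list lam"
    using assms(3) by (auto simp: RT_def)
  have fil: "is_filling lam T" and rw: "rows_weakly_decrease lam T"
    using rt by (simp_all add: is_reverse_tableau_def)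
  have comp: "is_composition lam" using assms(1) by (simp add: is_partition_def)
  define w where "w = first_column_word \<sigma> lam T"
  have msw: "mset w = mset (column lam T 1)" and stw: "stan w = \<sigma>"
    unfolding w_def by (rule first_column_word_spec[OF assms(1,2) rt])+
  have distT: "distinct (column lam T 1)"
    unfolding distinct_column[OF fil] by (rule RT_column_inj[OF rt])
  have w: "distinct w" "set w = colset T 1"
    using mset_eq_imp_distinct_iff[OF msw] mset_eq_setD[OF msw] distT set_column[OF fil, of 1]
    by simp_all
  have lw: "length w = n"
    using mset_eq_length[OF msw] column_1_composition[OF comp, of T] by (simp add: n_def del: upt_Suc)
  \<comment> \<open>The function q stands for column m + 1, indexed by rows: a rearrangement of that
    column of T within rows 1 to n, with the first column prescribed by w. Below, Q links
    neighbouring columns by the row and triple conditions.\<close>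
  define P where "P m q \<longleftrightarrow> inj_on q {r. q r \<noteq> 0} \<and> q ` {r. q r \<noteq> 0} = colset T (Suc m) \<and>
    {r. q r \<noteq> 0} \<subseteq> {1..n} \<and> (m = 0 \<longrightarrow> (\<forall>i\<in>{1..n}. q i = w ! (i - 1)))"
    for m and q :: "nat \<Rightarrow> nat"
  define Q where "Q p q \<longleftrightarrow> (\<forall>r. q r \<le> p r) \<and>
    (\<forall>i r. i < r \<and> q r \<noteq> 0 \<and> q r \<le> p i \<longrightarrow> q r < q i)" for p q :: "nat \<Rightarrow> nat"
  \<comment> \<open>The sequence of columns is infinite; beyond the last column of T the column sets
    are empty, which makes f zero there.\<close>
  have "\<exists>f. \<forall>m. P m (f m) \<and> Q (f m) (f (Suc m))"
  proof (rule dependent_nat_choice)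
    let ?q = "\<lambda>i. if i \<in> {1..n} then w ! (i - 1) else 0"
    have bij: "bij_betw ?q {1..n} (colset T 1)"
      using nth_pred_bij_betw[OF w(1)] unfolding lw w(2)
      by (rule bij_betw_cong[THEN iffD1, rotated]) simp
    have "?q i \<noteq> 0" if "i \<in> {1..n}" for i
    proof
      assume "?q i = 0"
      moreover have "?q i \<in> colset T 1" using bij_betwE[OF bij] that by blast
      ultimately show False by (simp only: zero_notin_colset)
    qed
    hence "{i. ?q i \<noteq> 0} = {1..n}" by auto
    hence "P 0 ?q" using bij by (auto simp: P_def bij_betw_def)
    thus "\<exists>q. P 0 q" by (rule exI[of _ ?q])
  next
    fix p m assume p: "P m p"
    have "\<exists>q. (\<forall>r. q r \<le> p r) \<and> inj_on q {r. q r \<noteq> 0} \<and>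
      q ` {r. q r \<noteq> 0} = colset T (Suc (Suc m)) \<and>
      (\<forall>i r. i < r \<and> q r \<noteq> 0 \<and> q r \<le> p i \<longrightarrow> q r < q i)"
    proof (rule ex_next_column)
      show "finite {r. p r \<noteq> 0}" using p by (auto simp: P_def intro: finite_subset)
      show "finite (colset T (Suc (Suc m)))" by (rule finite_colset[OF fil])
      show "0 \<notin> colset T (Suc (Suc m))" by (rule zero_notin_colset)
      fix s assume "s \<in> colset T (Suc (Suc m))"
      hence s: "0 < s" by (auto simp: colset_def)
      have "card {a \<in> colset T (Suc (Suc m)). s \<le> a} \<le> card {a \<in> colset T (Suc m). s \<le> a}"
        by (rule card_colset_ge_mono[OF fil rw RT_column_inj[OF rt] _ _ s]) simp_all
      also have "\<dots> = card {r. s \<le> p r}"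
        using card_image_ge[of p s] p s by (simp add: P_def)
      finally show "card {a \<in> colset T (Suc (Suc m)). s \<le> a} \<le> card {r. s \<le> p r}" .
    qed
    then obtain q where q: "\<forall>r. q r \<le> p r" "inj_on q {r. q r \<noteq> 0}"
      "q ` {r. q r \<noteq> 0} = colset T (Suc (Suc m))"
      "\<forall>i r. i < r \<and> q r \<noteq> 0 \<and> q r \<le> p i \<longrightarrow> q r < q i" by blast
    have "{r. q r \<noteq> 0} \<subseteq> {r. p r \<noteq> 0}"
    proof
      fix r assume "r \<in> {r. q r \<noteq> 0}"
      thus "r \<in> {r. p r \<noteq> 0}" using q(1)[rule_format, of r] by simp
    qed
    also have "\<dots> \<subseteq> {1..n}" using p by (simp add: P_def)
    finally have "P (Suc m) q" using q by (simp add: P_def)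
    moreover have "Q p q" using q by (simp add: Q_def)
    ultimately show "\<exists>q. P (Suc m) q \<and> Q p q" by blast
  qed
  then obtain f where f: "\<And>m. P m (f m)" "\<And>m. Q (f m) (f (Suc m))" by blast
  have f': "inj_on (f m) {r. f m r \<noteq> 0}" "f m ` {r. f m r \<noteq> 0} = colset T (Suc m)"
    "\<And>r. f m r \<noteq> 0 \<Longrightarrow> r \<in> {1..n}" "\<And>r. f (Suc m) r \<le> f m r"
    "\<And>i r. i < r \<Longrightarrow> f (Suc m) r \<noteq> 0 \<Longrightarrow> f (Suc m) r \<le> f m i \<Longrightarrow> f (Suc m) r < f (Suc m) i"
    for m using f(1)[of m] f(2)[of m] unfolding P_def Q_def by blast+
  define \<tau> where "\<tau> = (\<lambda>(i, j). if j = 0 then 0 else f (j - 1) i)"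
  have \<tau>: "\<tau> (i, Suc m) = f m i" "\<tau> (i, 0) = 0" for i m by (simp_all add: \<tau>_def)
  have T0: "T (i, 0) = 0" for i using fillingD[OF fil, of "(i, 0)"] by (auto simp: diagram_def)
  have cs: "colset \<tau> j = colset T j" for j
    using f'(2) by (cases j) (simp_all add: colset_def \<tau> T0)
  have inj: "inj_on (\<lambda>i. \<tau> (i, j)) {i. \<tau> (i, j) \<noteq> 0}" for j
    using f'(1) by (cases j) (simp_all add: \<tau>)
  have supp: "i \<in> {1..n}" if "\<tau> (i, j) \<noteq> 0" for i j
    using f'(3) that by (cases j) (simp_all add: \<tau>)
  have rows: "\<tau> (i, Suc j) \<le> \<tau> (i, j)" if "1 \<le> j" for i j
    using that f'(4) by (cases j) (simp_all add: \<tau>)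
  have trip: "\<tau> (r, Suc j) < \<tau> (i, Suc j)"
    if "1 \<le> j" "i < r" "\<tau> (r, Suc j) \<noteq> 0" "\<tau> (r, Suc j) \<le> \<tau> (i, j)" for i r j
    using that f'(5) by (cases j) (simp_all add: \<tau>)
  have first: "\<tau> (i, 1) = w ! (i - 1)" if "i \<in> {1..n}" for i
    using that f(1)[of 0] by (simp add: \<tau>_def P_def)
  have first0: "\<tau> (i, 1) \<noteq> 0" if "i \<in> {1..n}" for i
  proof -
    have "w ! (i - 1) \<in> set w" using that lw by auto
    thus ?thesis unfolding first[OF that] w(2) by (auto simp: colset_def)
  qed
  \<comment> \<open>The shape is not known beforehand and is read off the finished filling.\<close>
  define \<alpha> where "\<alpha> = row_lengths n \<tau>"
  have len: "length \<alpha> = n" by (simp add: \<alpha>_def row_lengths_def del: upt_Suc)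
  have row: "{j. \<tau> (i, j) \<noteq> 0} = {1..\<alpha> ! (i - 1)}" if i: "i \<in> {1..n}" for i
  proof -
    let ?D = "{j. \<tau> (i, j) \<noteq> 0}"
    \<comment> \<open>A nonempty column of \<tau> is a nonempty column of T, so its index is at most
      a part of \<open>lam\<close>. Finiteness is needed before the row can be identified with an
      interval.\<close>
    have "?D \<subseteq> {..sum_list lam}"
    proof
      fix j assume "j \<in> ?D"
      hence "colset T j \<noteq> {}" unfolding cs[symmetric] by (auto simp: colset_def)
      then obtain r where "T (r, j) \<noteq> 0" by (auto simp: colset_def)
      hence "r - 1 < length lam" "j \<le> lam ! (r - 1)"
        using fillingD[OF fil] by (auto simp: diagram_def)
      thus "j \<in> {..sum_list lam}" using elem_le_sum_list[of "r - 1" lam] by simp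
    qed
    hence "finite ?D" by (rule finite_subset) simp
    moreover have "k \<in> ?D" if "j \<in> ?D" "1 \<le> k" "k \<le> j" for j k
    proof -
      have "\<tau> (i, j) \<le> \<tau> (i, k)" using that(3)
        by (induction j rule: dec_induct) (use rows that(2) in \<open>auto intro: order_trans\<close>)
      thus ?thesis using that(1) by simp
    qed
    ultimately have "?D = {1..card ?D}" by (intro down_closed_eq_atLeastAtMost) (auto simp: \<tau>)
    moreover have "card ?D = \<alpha> ! (i - 1)"
      using i by (auto simp: \<alpha>_def row_lengths_def nth_append simp del: upt_Suc)
    ultimately show ?thesis by simp
  qed
  have fil\<tau>: "is_filling \<alpha> \<tau>"
    unfolding is_filling_def
  proof
    fix c :: "nat \<times> nat" obtain i j where c: "c = (i, j)" by force
    show "0 < \<tau> c \<longleftrightarrow> c \<in> diagram \<alpha>"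
    proof (cases "i \<in> {1..n}")
      case True
      have "\<tau> (i, j) \<noteq> 0 \<longleftrightarrow> j \<in> {1..\<alpha> ! (i - 1)}" using row[OF True] by blast
      thus ?thesis using True by (auto simp: c diagram_def len)
    next
      case False
      thus ?thesis using supp[of i j] by (auto simp: c diagram_def len)
    qed
  qed
  have comp\<alpha>: "is_composition \<alpha>"
    unfolding is_composition_def
  proof
    fix a assume "a \<in> set \<alpha>"
    then obtain i where i: "i < n" "a = \<alpha> ! i" using len by (auto simp: in_set_conv_nth)
    hence "1 \<in> {j. \<tau> (Suc i, j) \<noteq> 0}" using first0[of "Suc i"] by simp
    also have "\<dots> = {1..\<alpha> ! i}" using row[of "Suc i"] i by simp
    finally show "0 < a" using i by simp
  qed
  \<comment> \<open>Equal column sets with distinct entries give equal column heights, and these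
    determine the parts up to order.\<close>
  have "mset \<alpha> = mset lam"
  proof (rule mset_eq_if_size_ge_eq)
    show "0 \<notin># mset \<alpha>" "0 \<notin># mset lam" using comp comp\<alpha> by (auto simp: is_composition_def)
    fix j :: nat assume "1 \<le> j"
    thus "size (filter_mset (\<lambda>x. j \<le> x) (mset \<alpha>)) = size (filter_mset (\<lambda>x. j \<le> x) (mset lam))"
      using card_colset[OF fil\<tau> inj, of j] card_colset[OF fil RT_column_inj[OF rt], of j]
      by (simp add: card_diagram_col[symmetric] cs)
  qed
  hence lam: "dsort \<alpha> = lam" by (rule dsort_eq_partition[OF assms(1)])
  have "column \<alpha> \<tau> 1 = w"
    unfolding column_1_composition[OF comp\<alpha>]
  proof (rule nth_equalityI)
    fix i assume "i < length (map (\<lambda>i. \<tau> (i, 1)) [1..<Suc (length \<alpha>)])"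
    thus "map (\<lambda>i. \<tau> (i, 1)) [1..<Suc (length \<alpha>)] ! i = w ! i"
      using first[of "Suc i"] by (simp add: len del: upt_Suc)
  qed (simp add: len lw del: upt_Suc)
  moreover have "triple_condition \<alpha> \<tau>" unfolding triple_condition_iff[OF fil\<tau>] using trip by blast
  moreover have "rows_weakly_decrease \<alpha> \<tau>"
    unfolding rows_weakly_decrease_iff[OF fil\<tau>] using rows by blast
  ultimately have pct: "is_PCT \<sigma> \<alpha> \<tau>" using fil\<tau> w(1) stw by (simp add: is_PCT_def)
  have "\<tau> c \<le> sum_list \<alpha>" if "c \<in> diagram \<alpha>" for c
  proof -
    obtain i j where c: "c = (i, j)" by force
    have "\<tau> (i, j) \<noteq> 0" using that fillingD[OF fil\<tau>] c by blast
    hence "\<tau> c \<in> colset \<tau> j" unfolding c colset_def by blast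
    hence "\<tau> c \<in> colset T j" by (simp only: cs)
    then obtain r where "\<tau> c = T (r, j)" "T (r, j) \<noteq> 0" by (auto simp: colset_def)
    thus ?thesis using bound[of "(r, j)"] fillingD[OF fil] lam sum_list_dsort[of \<alpha>] by simp
  qed
  hence "(\<alpha>, \<tau>) \<in> PCT_coproduct \<sigma> lam"
    using pct comp\<alpha> lam by (simp add: PCT_coproduct_def PCT_def)
  moreover have "Psi (\<alpha>, \<tau>) = T"
  proof
    fix c :: "nat \<times> nat" obtain i j where c: "c = (i, j)" by force
    show "Psi (\<alpha>, \<tau>) c = T c"
      using RT_column_desc[OF assms(1) rt, of i j] fillingD[OF fil, of "(i, j)"]
      by (auto simp: c Psi_apply[OF pct] lam cs)
  qed
  ultimately show ?thesis by blast
qed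

theorem theorem2p4:
  fixes lam :: "nat list" and \<sigma> :: "nat \<Rightarrow> nat"
  assumes "is_partition lam" and "\<sigma> permutes {1..length lam}"
  shows "bij_betw Psi (PCT_coproduct \<sigma> lam) (RT lam) \<and>
    phi_bar \<sigma> lam \<in> RT lam \<rightarrow> PCT_coproduct \<sigma> lam \<and>
    (\<forall>x\<in>PCT_coproduct \<sigma> lam. phi_bar \<sigma> lam (Psi x) = x) \<and>
    (\<forall>T\<in>RT lam. Psi (phi_bar \<sigma> lam T) = T)"
proof -
  have left: "\<forall>x\<in>PCT_coproduct \<sigma> lam. phi_bar \<sigma> lam (Psi x) = x"
    using phi_bar_Psi[OF assms] by blast
  have RT_eq: "RT lam = Psi ` PCT_coproduct \<sigma> lam"
    using Psi_in_RT[OF assms(1)] Psi_surj[OF assms] by blast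
  have "bij_betw Psi (PCT_coproduct \<sigma> lam) (RT lam)"
    unfolding bij_betw_def using RT_eq left by (auto intro: inj_on_inverseI)
  \<comment> \<open>Every T is \<open>Psi x\<close> for some x in the coproduct, and the left
    inverse law returns this x; both membership and the right inverse law follow.\<close>
  thus ?thesis using RT_eq left by auto
qed

end
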